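(* For every hypergraph $\mathcal{H}$, $$\tilde{H}_i(\mathrm{NC}(\mathcal{H})) = 0 \quad\text{for all } i \geq |V(\mathcal{H})| - \max\left\{ \left\lceil\frac{\tilde{\gamma}(\mathcal{H})}{2}\right\rceil, \gamma_{si}(\mathcal{H}), \gamma_E(\mathcal{H})\right\} - 1.$$
   Context: A hypergraph $\mathcal{H}$ on a finite vertex set $V=V(\mathcal{H})$ is a collection of distinct non-empty subsets of $V$, called edges. A singleton edge $\{v\}$ is called a loop. A vertex is isolated if no edge contains it. Noncover complex: a set $W\subseteq V$ is a cover of $\mathcal{H}$ if it meets every edge, and a noncover otherwise. $\mathrm{NC}(\mathcal{H})$ is the abstract simplicial complex on $V$ whose faces are the noncovers of $\mathcal{H}$; its maximal faces are complements of edges. If $\mathcal{H}$ has no edges, $\mathrm{NC}(\mathcal{H})=\emptyset$ is the void complex (no faces, vanishing reduced homology in all dimensions). The empty complex $\{\emptyset\}$ has $\tilde{H}_{-1}$ of rank 1 and all other reduced homology zero. $\tilde{H}_i$ denotes $i$-dimensional reduced homology with coefficients in $\mathbb{Z}_2$. Domination: $W\subseteq V$ dominates a vertex $v$ if there is $W'\subseteq W\setminus\{v\}$ with $W'\cup\{v\}\in\mathcal{H}$ (in particular the empty set dominates $v$ if $\{v\}$ is a loop). $W$ dominates $A\subseteq V$ if it dominates every vertex of $A$. Let $\gamma(\mathcal{H};A)=\min\{|W| : W\subseteq V,\ W \text{ dominates } A\}$ and $\tilde{\gamma}(\mathcal{H})=\gamma(\mathcal{H};V)$. A set $A\subseteq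 V$ is independent if it contains no edge of $\mathcal{H}$; it is strongly independent if it is independent and every edge contains at most one vertex of $A$. Let $\gamma_{si}(\mathcal{H})=\max\{\gamma(\mathcal{H};A) : A \text{ strongly independent in } \mathcal{H}\}$. Let $\gamma_E(\mathcal{H})=\min\{|\mathcal{F}| : \mathcal{F}\subseteq\mathcal{H},\ \bigcup_{F\in\mathcal{F}}F \text{ dominates } V\}$. If $\mathcal{H}$ has an isolated vertex, all of $\tilde{\gamma}(\mathcal{H}),\gamma_{si}(\mathcal{H}),\gamma_E(\mathcal{H})$ are defined to be $\infty$ (so the conclusion then is for all $i$). *)

theory Defs
  imports
    "HOL-Algebra.Elementary_Groups"
    "HOL-Library.Z2"
    "HOL-Library.Extended_Nat"
    "HOL-Library.Extended_Real"
begin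

section \<open>Hypergraphs\<close>

definition hypergraph :: "'a set \<Rightarrow> 'a set set \<Rightarrow> bool" where
  "hypergraph V H \<longleftrightarrow> finite V \<and> (\<forall>e\<in>H. e \<noteq> {} \<and> e \<subseteq> V)"

definition has_isolated_vertex :: "'a set \<Rightarrow> 'a set set \<Rightarrow> bool" where
  "has_isolated_vertex V H \<longleftrightarrow> (\<exists>v\<in>V. \<forall>e\<in>H. v \<notin> e)"

definition cover :: "'a set \<Rightarrow> 'a set set \<Rightarrow> 'a set \<Rightarrow> bool" where
  "cover V H W \<longleftrightarrow> W \<subseteq> V \<and> (\<forall>e\<in>H. W \<inter> e \<noteq> {})"

definition noncover_complex :: "'a set \<Rightarrow> 'a set set \<Rightarrow> 'a set set" where
  "noncover_complex V H = {W. W \<subseteq> V \<and> \<not> cover V H W}"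

section \<open>Domination\<close>

definition dominates_vertex :: "'a set set \<Rightarrow> 'a set \<Rightarrow> 'a \<Rightarrow> bool" where
  "dominates_vertex H W v \<longleftrightarrow> (\<exists>W'. W' \<subseteq> W - {v} \<and> W' \<union> {v} \<in> H)"

definition dominates :: "'a set set \<Rightarrow> 'a set \<Rightarrow> 'a set \<Rightarrow> bool" where
  "dominates H W A \<longleftrightarrow> (\<forall>v\<in>A. dominates_vertex H W v)"

definition independent_set :: "'a set \<Rightarrow> 'a set set \<Rightarrow> 'a set \<Rightarrow> bool" where
  "independent_set V H A \<longleftrightarrow> A \<subseteq> V \<and> \<not> (\<exists>e\<in>H. e \<subseteq> A)"

definition strongly_independent :: "'a set \<Rightarrow> 'a set set \<Rightarrow> 'a set \<Rightarrow> bool" where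
  "strongly_independent V H A \<longleftrightarrow>
     independent_set V H A \<and> (\<forall>e\<in>H. card (e \<inter> A) \<le> 1)"

text \<open>
  The parameters take values in \<^typ>\<open>enat\<close>. An infimum in \<^typ>\<open>enat\<close> is attained unless
  the index set is empty, in which case it is \<open>\<infinity>\<close>; the supremum defining \<open>\<gamma>\<^sub>s\<^sub>i\<close> is over
  a finite set containing the empty set whenever \<open>V\<close> is finite and all edges are non-empty.
  So these are the minima and the maximum of the usual definitions.
\<close>

definition gamma :: "'a set \<Rightarrow> 'a set set \<Rightarrow> 'a set \<Rightarrow> enat" where
  "gamma V H A = (INF W \<in> {W. W \<subseteq> V \<and> dominates H W A}. enat (card W))"

definition gamma_tilde :: "'a set \<Rightarrow> 'a set set \<Rightarrow> enat" where
  "gamma_tilde V H = (if has_isolated_vertex V H then \<infinity> else gamma V H V)"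

definition gamma_si :: "'a set \<Rightarrow> 'a set set \<Rightarrow> enat" where
  "gamma_si V H =
     (if has_isolated_vertex V H then \<infinity>
      else (SUP A \<in> {A. strongly_independent V H A}. gamma V H A))"

definition gamma_E :: "'a set \<Rightarrow> 'a set set \<Rightarrow> enat" where
  "gamma_E V H =
     (if has_isolated_vertex V H then \<infinity>
      else (INF F \<in> {F. F \<subseteq> H \<and> dominates H (\<Union>F) V}. enat (card F)))"

definition ceil_half :: "enat \<Rightarrow> enat" where
  "ceil_half x = (case x of enat n \<Rightarrow> enat (nat \<lceil>real n / 2\<rceil>) | \<infinity> \<Rightarrow> \<infinity>)"

section \<open>Reduced simplicial homology over the field with two elements\<close>

text \<open>
  A complex is given by its set of faces, so \<open>{}\<close> is the void complex and \<open>{{}}\<close> is the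
  complex whose only face is the empty one. The dimension \<open>i\<close> is an integer: the empty face
  has dimension \<open>-1\<close>, and all chain groups below dimension \<open>-1\<close> are trivial.
\<close>

definition faces_of_dim :: "'a set set \<Rightarrow> int \<Rightarrow> 'a set set" where
  "faces_of_dim X i = {\<sigma> \<in> X. finite \<sigma> \<and> int (card \<sigma>) = i + 1}"

definition Z2_chain_group :: "'a set set \<Rightarrow> int \<Rightarrow> ('a set \<Rightarrow> bit) monoid" where
  "Z2_chain_group X i =
     \<lparr>carrier = {c. finite {\<sigma>. c \<sigma> \<noteq> 0} \<and> {\<sigma>. c \<sigma> \<noteq> 0} \<subseteq> faces_of_dim X i},
      monoid.mult = (\<lambda>c d \<sigma>. c \<sigma> + d \<sigma>),
      one = (\<lambda>\<sigma>. 0)\<rparr>"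

text \<open>
  The linear extension of \<open>\<sigma> \<mapsto> (\<Sum>v\<in>\<sigma>. \<sigma> - {v})\<close>, written as the coefficient of each \<open>\<tau>\<close>.
  On vertices it is the augmentation onto the span of the empty face.
\<close>

definition Z2_boundary :: "('a set \<Rightarrow> bit) \<Rightarrow> ('a set \<Rightarrow> bit)" where
  "Z2_boundary c = (\<lambda>\<tau>. \<Sum>\<sigma> | c \<sigma> \<noteq> 0 \<and> (\<exists>v\<in>\<sigma>. \<tau> = \<sigma> - {v}). c \<sigma>)"

definition Z2_cycles :: "'a set set \<Rightarrow> int \<Rightarrow> ('a set \<Rightarrow> bit) set" where
  "Z2_cycles X i = kernel (Z2_chain_group X i) (Z2_chain_group X (i - 1)) Z2_boundary"

definition Z2_boundaries :: "'a set set \<Rightarrow> int \<Rightarrow> ('a set \<Rightarrow> bit) set" where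
  "Z2_boundaries X i = Z2_boundary ` carrier (Z2_chain_group X (i + 1))"

definition Z2_reduced_homology :: "'a set set \<Rightarrow> int \<Rightarrow> ('a set \<Rightarrow> bit) set monoid" where
  "Z2_reduced_homology X i =
     (Z2_chain_group X i)\<lparr>carrier := Z2_cycles X i\<rparr> Mod Z2_boundaries X i"

end

theory Submission
  imports Defs
begin

text \<open>
  For an edge \<open>e\<close>, the noncover complex of \<open>H\<close> is the union of the noncover complex of \<open>H - {e}\<close>
  and the full simplex on \<open>V - e\<close>. If \<open>e\<close> is inclusion-minimal, they intersect in the noncover
  complex of the contraction \<open>{f - e | f \<in> H - {e}}\<close> on \<open>V - e\<close>; otherwise deleting \<open>e\<close> changes
  nothing. By Mayer-Vietoris and induction on the number of edges, it is enough to bound how the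
  three parameters change under deletion (they do not decrease) and contraction of a non-loop
  edge (they decrease by at most \<open>card e - 1\<close>). For \<open>\<gamma>\<^sub>s\<^sub>i\<close> this is true for edges meeting a fixed
  strongly independent set \<open>A\<close>. The induction ends at isolated vertices, where the complex is a cone,
  or when only loops are left, where the claim holds for dimension reasons.
\<close>

section \<open>Reduced homology of finite complexes over the two-element field\<close>

text \<open>The default rules for \<^typ>\<open>bit\<close> would rewrite all sums of coefficients to \<^const>\<open>of_bool\<close> terms.\<close>

declare add_bit_eq_xor [simp del] mult_bit_eq_and [simp del] bit_not_zero_iff [simp del]

lemma bit_add_self [simp]: "a + a = (0::bit)"
  by (cases a) auto

lemma bit_add_eq_0_iff [simp]: "a + b = 0 \<longleftrightarrow> a = (b::bit)"
  by (cases a; cases b) auto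

lemma bit_add_neq_0D: "a + b \<noteq> (0::bit) \<Longrightarrow> a \<noteq> 0 \<or> b \<noteq> 0"
  by auto

text \<open>The terms at \<open>(v, w)\<close> and \<open>(w, v)\<close> cancel in characteristic 2.
  This is what makes the boundary square to zero.\<close>

lemma sum_bit_symmetric_off_diagonal:
  fixes g :: "'b \<Rightarrow> 'b \<Rightarrow> bit"
  assumes "finite U" and sym: "\<And>v w. g v w = g w v"
  shows "(\<Sum>v\<in>U. \<Sum>w\<in>U - {v}. g v w) = 0"
  using \<open>finite U\<close>
proof (induction U rule: finite_induct)
  case (insert x U)
  have "(\<Sum>v\<in>insert x U. \<Sum>w\<in>insert x U - {v}. g v w)
      = (\<Sum>w\<in>U. g x w) + (\<Sum>v\<in>U. \<Sum>w\<in>insert x U - {v}. g v w)"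
    using insert by simp
  also have "(\<Sum>v\<in>U. \<Sum>w\<in>insert x U - {v}. g v w) = (\<Sum>v\<in>U. g v x + (\<Sum>w\<in>U - {v}. g v w))"
  proof (rule sum.cong)
    fix v assume "v \<in> U"
    with insert have "insert x U - {v} = insert x (U - {v})" by auto
    then show "(\<Sum>w\<in>insert x U - {v}. g v w) = g v x + (\<Sum>w\<in>U - {v}. g v w)"
      using insert by simp
  qed simp
  also have "\<dots> = (\<Sum>w\<in>U. g x w)"
    using insert.IH by (simp add: sum.distrib sym[of _ x])
  finally show ?case by simp
qed simp

section \<open>Chain groups and the boundary operator\<close>

definition simplicial_complex_on :: "'a set \<Rightarrow> 'a set set \<Rightarrow> bool" where
  "simplicial_complex_on V X \<longleftrightarrow> finite V \<and> (\<forall>\<sigma>\<in>X. \<sigma> \<subseteq> V \<and> (\<forall>\<tau>\<subseteq>\<sigma>. \<tau> \<in> X))"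

lemma Z2_chain_group_iff:
  assumes "simplicial_complex_on V X"
  shows "c \<in> carrier (Z2_chain_group X i) \<longleftrightarrow> (\<forall>\<sigma>. c \<sigma> \<noteq> 0 \<longrightarrow> \<sigma> \<in> X \<and> int (card \<sigma>) = i + 1)"
proof -
  have "finite X" "\<And>\<sigma>. \<sigma> \<in> X \<Longrightarrow> finite \<sigma>"
    using assms finite_subset[of X "Pow V"]
    by (auto simp: simplicial_complex_on_def intro: finite_subset)
  then show ?thesis
    unfolding Z2_chain_group_def faces_of_dim_def
    by (auto intro: finite_subset[of _ X] simp: subset_iff)
qed

lemma Z2_chain_group_add:
  assumes "simplicial_complex_on V X"
    and "c \<in> carrier (Z2_chain_group X i)" "d \<in> carrier (Z2_chain_group X i)"
  shows "(\<lambda>\<sigma>. c \<sigma> + d \<sigma>) \<in> carrier (Z2_chain_group X i)"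
  using assms(2,3) bit_add_neq_0D unfolding Z2_chain_group_iff[OF assms(1)] by blast

lemma Z2_chain_support:
  assumes "simplicial_complex_on V X" "c \<in> carrier (Z2_chain_group X i)" "c \<sigma> \<noteq> 0"
  shows "\<sigma> \<subseteq> V"
  using assms(2,3) unfolding Z2_chain_group_iff[OF assms(1)]
  using assms(1) by (auto simp: simplicial_complex_on_def)

lemma Z2_chain_group_mono:
  assumes "X \<subseteq> Y" "c \<in> carrier (Z2_chain_group X i)"
  shows "c \<in> carrier (Z2_chain_group Y i)"
  using assms by (auto simp: Z2_chain_group_def faces_of_dim_def)

text \<open>Indexing by the added vertex instead of by the coface gives a range that does not depend
  on \<open>c\<close>, so additivity and the vanishing of the double boundary become manipulations
  of finite sums.\<close>

lemma Z2_boundary_eq_sum: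
  assumes "finite V" and "\<And>\<sigma>. c \<sigma> \<noteq> 0 \<Longrightarrow> \<sigma> \<subseteq> V"
  shows "Z2_boundary c \<tau> = (\<Sum>v\<in>V - \<tau>. c (insert v \<tau>))"
proof -
  let ?S = "{v \<in> V - \<tau>. c (insert v \<tau>) \<noteq> 0}"
  have "{\<sigma>. c \<sigma> \<noteq> 0 \<and> (\<exists>v\<in>\<sigma>. \<tau> = \<sigma> - {v})} = (\<lambda>v. insert v \<tau>) ` ?S"
  proof (intro equalityI subsetI)
    fix \<sigma> assume "\<sigma> \<in> {\<sigma>. c \<sigma> \<noteq> 0 \<and> (\<exists>v\<in>\<sigma>. \<tau> = \<sigma> - {v})}"
    then obtain v where v: "c \<sigma> \<noteq> 0" "v \<in> \<sigma>" "\<tau> = \<sigma> - {v}" by blast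
    have eq: "insert v \<tau> = \<sigma>" using v(2,3) by auto
    have "v \<in> ?S" using v assms(2)[OF v(1)] unfolding mem_Collect_eq eq by blast
    then show "\<sigma> \<in> (\<lambda>v. insert v \<tau>) ` ?S" using eq by (intro image_eqI[of _ _ v]) simp_all
  next
    fix \<sigma> assume "\<sigma> \<in> (\<lambda>v. insert v \<tau>) ` ?S"
    then obtain v where v: "v \<notin> \<tau>" "c \<sigma> \<noteq> 0" "\<sigma> = insert v \<tau>" by blast
    have "\<tau> = \<sigma> - {v}" "v \<in> \<sigma>" using v(1,3) by auto
    with v(2) show "\<sigma> \<in> {\<sigma>. c \<sigma> \<noteq> 0 \<and> (\<exists>v\<in>\<sigma>. \<tau> = \<sigma> - {v})}"
      by blast
  qed
  moreover have "inj_on (\<lambda>v. insert v \<tau>) ?S"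
  proof (rule inj_onI)
    fix v w assume "v \<in> ?S" "w \<in> ?S" "insert v \<tau> = insert w \<tau>"
    then show "v = w" by (metis (no_types, lifting) DiffD2 insertE insertI1 mem_Collect_eq)
  qed
  ultimately have "Z2_boundary c \<tau> = (\<Sum>v\<in>?S. c (insert v \<tau>))"
    by (simp add: Z2_boundary_def sum.reindex)
  also have "\<dots> = (\<Sum>v\<in>V - \<tau>. c (insert v \<tau>))"
    using \<open>finite V\<close> by (intro sum.mono_neutral_left) auto
  finally show ?thesis .
qed

lemma Z2_boundary_add:
  assumes "finite V" "\<And>\<sigma>. c \<sigma> \<noteq> 0 \<Longrightarrow> \<sigma> \<subseteq> V" "\<And>\<sigma>. d \<sigma> \<noteq> 0 \<Longrightarrow> \<sigma> \<subseteq> V"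
  shows "Z2_boundary (\<lambda>\<sigma>. c \<sigma> + d \<sigma>) = (\<lambda>\<tau>. Z2_boundary c \<tau> + Z2_boundary d \<tau>)"
proof
  fix \<tau>
  have "\<sigma> \<subseteq> V" if "c \<sigma> + d \<sigma> \<noteq> 0" for \<sigma>
    using bit_add_neq_0D[OF that] assms(2,3)[of \<sigma>] by blast
  then show "Z2_boundary (\<lambda>\<sigma>. c \<sigma> + d \<sigma>) \<tau> = Z2_boundary c \<tau> + Z2_boundary d \<tau>"
    using Z2_boundary_eq_sum[OF \<open>finite V\<close>, of "\<lambda>\<sigma>. c \<sigma> + d \<sigma>" \<tau>]
      Z2_boundary_eq_sum[OF \<open>finite V\<close>, of c \<tau>] Z2_boundary_eq_sum[OF \<open>finite V\<close>, of d \<tau>] assms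
    by (simp add: sum.distrib)
qed

lemma Z2_boundary_chain:
  assumes X: "simplicial_complex_on V X" and c: "c \<in> carrier (Z2_chain_group X i)"
  shows "Z2_boundary c \<in> carrier (Z2_chain_group X (i - 1))"
  unfolding Z2_chain_group_iff[OF X]
proof (intro allI impI)
  fix \<tau> assume "Z2_boundary c \<tau> \<noteq> 0"
  then obtain \<sigma> v where \<sigma>: "c \<sigma> \<noteq> 0" "v \<in> \<sigma>" "\<tau> = \<sigma> - {v}"
    unfolding Z2_boundary_def by (blast elim: sum.not_neutral_contains_not_neutral)
  then have "\<sigma> \<in> X" "int (card \<sigma>) = i + 1"
    using c by (auto simp: Z2_chain_group_iff[OF X])
  moreover from this have "finite \<sigma>" "\<tau> \<in> X"
    using X \<sigma> by (auto simp: simplicial_complex_on_def intro: finite_subset)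
  ultimately show "\<tau> \<in> X \<and> int (card \<tau>) = i - 1 + 1"
    using \<sigma> card_Suc_Diff1[of \<sigma> v] by simp
qed

text \<open>The coefficient at \<open>\<tau>\<close> sums \<open>c\<close> over the sets obtained by
  adding two distinct vertices, and each such set is counted once for either order.\<close>

lemma Z2_boundary_boundary:
  assumes "finite V" and c: "\<And>\<sigma>. c \<sigma> \<noteq> 0 \<Longrightarrow> \<sigma> \<subseteq> V"
  shows "Z2_boundary (Z2_boundary c) = (\<lambda>_. 0)"
proof
  fix \<tau>
  have bd: "Z2_boundary c \<rho> = (\<Sum>v\<in>V - \<rho>. c (insert v \<rho>))" for \<rho>
    using c by (rule Z2_boundary_eq_sum[OF \<open>finite V\<close>])
  have "\<sigma> \<subseteq> V" if "Z2_boundary c \<sigma> \<noteq> 0" for \<sigma>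
  proof -
    obtain v where "c (insert v \<sigma>) \<noteq> 0"
      using \<open>Z2_boundary c \<sigma> \<noteq> 0\<close> unfolding bd
      by (blast elim: sum.not_neutral_contains_not_neutral)
    then show ?thesis using c by blast
  qed
  then have "Z2_boundary (Z2_boundary c) \<tau> = (\<Sum>v\<in>V - \<tau>. Z2_boundary c (insert v \<tau>))"
    by (rule Z2_boundary_eq_sum[OF \<open>finite V\<close>])
  also have "\<dots> = (\<Sum>v\<in>V - \<tau>. \<Sum>w\<in>V - \<tau> - {v}. c (insert w (insert v \<tau>)))"
    unfolding bd by (intro sum.cong) auto
  also have "\<dots> = 0"
    using \<open>finite V\<close> by (intro sum_bit_symmetric_off_diagonal) (auto simp: insert_commute)
  finally show "Z2_boundary (Z2_boundary c) \<tau> = 0" .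
qed

section \<open>Acyclicity in a single degree\<close>

text \<open>Expresses vanishing of homology without the quotient group; for a complex the other
  inclusion is automatic.\<close>

definition acyclic_in_dim :: "'a set set \<Rightarrow> int \<Rightarrow> bool" where
  "acyclic_in_dim X i \<longleftrightarrow> Z2_cycles X i \<subseteq> Z2_boundaries X i"

lemma Z2_cycles_iff:
  "c \<in> Z2_cycles X i \<longleftrightarrow> c \<in> carrier (Z2_chain_group X i) \<and> Z2_boundary c = (\<lambda>_. 0)"
  by (simp add: Z2_cycles_def kernel_def Z2_chain_group_def)

lemma acyclic_in_dimI:
  assumes "\<And>c. c \<in> carrier (Z2_chain_group X i) \<Longrightarrow> Z2_boundary c = (\<lambda>_. 0) \<Longrightarrow>
    \<exists>d\<in>carrier (Z2_chain_group X (i + 1)). Z2_boundary d = c"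
  shows "acyclic_in_dim X i"
  unfolding acyclic_in_dim_def Z2_boundaries_def
proof
  fix c assume "c \<in> Z2_cycles X i"
  then show "c \<in> Z2_boundary ` carrier (Z2_chain_group X (i + 1))"
    using assms[of c] by (auto simp only: Z2_cycles_iff)
qed

lemma acyclic_in_dimE:
  assumes "acyclic_in_dim X i" "c \<in> carrier (Z2_chain_group X i)" "Z2_boundary c = (\<lambda>_. 0)"
  obtains d where "d \<in> carrier (Z2_chain_group X (i + 1))" "Z2_boundary d = c"
proof -
  have "c \<in> Z2_boundaries X i"
    using assms unfolding acyclic_in_dim_def by (meson Z2_cycles_iff subsetD)
  then show thesis
    using that unfolding Z2_boundaries_def by blast
qed

text \<open>The cycles form a group containing the boundaries. Acyclicity makes the two equal, so
  the quotient has a single coset.\<close>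

lemma Z2_reduced_homology_trivial:
  assumes X: "simplicial_complex_on V X" and "acyclic_in_dim X i"
  shows "trivial_group (Z2_reduced_homology X i)"
proof -
  let ?Z = "Z2_chain_group X i\<lparr>carrier := Z2_cycles X i\<rparr>"
  have fin: "finite V" using X by (simp add: simplicial_complex_on_def)
  have sub: "\<sigma> \<subseteq> V" if "c \<in> carrier (Z2_chain_group X k)" "c \<sigma> \<noteq> 0" for c k \<sigma>
    using that X by (auto simp: Z2_chain_group_iff[OF X] simplicial_complex_on_def)
  have add: "(\<lambda>\<sigma>. c \<sigma> + d \<sigma>) \<in> Z2_cycles X i" if "c \<in> Z2_cycles X i" "d \<in> Z2_cycles X i" for c d
  proof -
    have "Z2_boundary (\<lambda>\<sigma>. c \<sigma> + d \<sigma>) = (\<lambda>\<tau>. Z2_boundary c \<tau> + Z2_boundary d \<tau>)"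
      using that sub[of c i] sub[of d i]
      by (intro Z2_boundary_add[OF fin]) (simp_all add: Z2_cycles_iff)
    with that Z2_chain_group_add[OF X] show ?thesis
      by (simp add: Z2_cycles_iff)
  qed
  have zero: "(\<lambda>_. 0) \<in> Z2_cycles X i"
    by (simp add: Z2_cycles_iff Z2_chain_group_iff[OF X] Z2_boundary_def)
  interpret Z: group ?Z
  proof (rule groupI)
    fix c assume "c \<in> carrier ?Z"
    \<comment> \<open>Over the two-element field every chain is its own inverse.\<close>
    then show "\<exists>d\<in>carrier ?Z. d \<otimes>\<^bsub>?Z\<^esub> c = \<one>\<^bsub>?Z\<^esub>"
      by (intro bexI[of _ c]) (auto simp: Z2_chain_group_def)
  next
    show "\<one>\<^bsub>?Z\<^esub> \<in> carrier ?Z"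
      using zero by (simp add: Z2_chain_group_def)
    show "c \<otimes>\<^bsub>?Z\<^esub> d \<in> carrier ?Z" if "c \<in> carrier ?Z" "d \<in> carrier ?Z" for c d
      using add that by (simp add: Z2_chain_group_def)
  qed (simp_all add: Z2_chain_group_def add.assoc)
  have "Z2_boundaries X i \<subseteq> Z2_cycles X i"
  proof
    fix c assume "c \<in> Z2_boundaries X i"
    then obtain d where d: "d \<in> carrier (Z2_chain_group X (i + 1))" "c = Z2_boundary d"
      by (auto simp: Z2_boundaries_def)
    then show "c \<in> Z2_cycles X i"
      using Z2_boundary_chain[OF X d(1)] Z2_boundary_boundary[OF fin, of d] sub[OF d(1)]
      by (simp add: Z2_cycles_iff)
  qed
  with \<open>acyclic_in_dim X i\<close> have "Z2_boundaries X i = carrier ?Z"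
    by (auto simp: acyclic_in_dim_def)
  then have "Z2_reduced_homology X i = ?Z Mod carrier ?Z"
    by (simp add: Z2_reduced_homology_def)
  moreover have "carrier (?Z Mod carrier ?Z) \<subseteq> {carrier ?Z}"
    using Z.coset_join2[OF _ Z.subgroup_self] by (auto simp: FactGroup_def RCOSETS_def)
  moreover have "group (?Z Mod carrier ?Z)"
    by (rule normal.factorgroup_is_group[OF Z.normal_self])
  ultimately show ?thesis
    by (metis group.trivial_group_alt)
qed

text \<open>Coning with apex \<open>v\<close> is a contracting homotopy: in characteristic 2 a cycle
  is the boundary of its cone.\<close>

lemma acyclic_in_dim_cone:
  assumes X: "simplicial_complex_on V X" and "v \<in> V"
    and cone: "\<And>\<sigma>. \<sigma> \<in> X \<Longrightarrow> insert v \<sigma> \<in> X"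
  shows "acyclic_in_dim X i"
proof (rule acyclic_in_dimI)
  fix c assume c: "c \<in> carrier (Z2_chain_group X i)" and cyc: "Z2_boundary c = (\<lambda>_. 0)"
  have fin: "finite V" and sub: "\<And>\<sigma>. \<sigma> \<in> X \<Longrightarrow> \<sigma> \<subseteq> V"
    using X by (auto simp: simplicial_complex_on_def)
  \<comment> \<open>The cone over those faces of \<open>c\<close> that avoid \<open>v\<close>. Faces
    of \<open>c\<close> through \<open>v\<close> are recovered from the cycle condition.\<close>
  define d where "d \<sigma> = (if v \<in> \<sigma> then c (\<sigma> - {v}) else 0)" for \<sigma>
  have d: "d \<in> carrier (Z2_chain_group X (i + 1))"
    unfolding Z2_chain_group_iff[OF X]
  proof (intro allI impI)
    fix \<sigma> assume "d \<sigma> \<noteq> 0"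
    then have "v \<in> \<sigma>" "c (\<sigma> - {v}) \<noteq> 0" by (auto simp: d_def split: if_splits)
    moreover from this c have "\<sigma> - {v} \<in> X" "int (card (\<sigma> - {v})) = i + 1"
      by (auto simp: Z2_chain_group_iff[OF X])
    moreover from this have "finite \<sigma>" "insert v (\<sigma> - {v}) \<in> X"
      using sub fin cone[of "\<sigma> - {v}"] finite_subset[of "\<sigma> - {v}" V] by simp_all
    ultimately show "\<sigma> \<in> X \<and> int (card \<sigma>) = i + 1 + 1"
      using card_Suc_Diff1[of \<sigma> v] by (simp add: insert_absorb)
  qed
  have "Z2_boundary d \<tau> = c \<tau>" for \<tau>
  proof -
    have "Z2_boundary d \<tau> = (\<Sum>w\<in>V - \<tau>. d (insert w \<tau>))"
      using d sub by (intro Z2_boundary_eq_sum[OF fin]) (auto simp: Z2_chain_group_iff[OF X])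
    also have "\<dots> = c \<tau>"
    proof (cases "v \<in> \<tau>")
      case False
      then have "(\<Sum>w\<in>V - \<tau>. d (insert w \<tau>)) = (\<Sum>w\<in>{v}. d (insert w \<tau>))"
        using \<open>v \<in> V\<close> fin by (intro sum.mono_neutral_right) (auto simp: d_def)
      moreover have "d (insert v \<tau>) = c \<tau>"
        using False by (simp add: d_def)
      ultimately show ?thesis by simp
    next
      case True
      \<comment> \<open>The cycle condition at \<open>\<tau> - {v}\<close> expresses
        \<open>c \<tau>\<close> by faces avoiding \<open>v\<close>, which are the ones that
        \<open>d\<close> cones over.\<close>
      let ?\<rho> = "\<tau> - {v}"
      have V: "V - ?\<rho> = insert v (V - \<tau>)" using True \<open>v \<in> V\<close> by auto
      have "Z2_boundary c ?\<rho> = (\<Sum>w\<in>V - ?\<rho>. c (insert w ?\<rho>))"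
        using c sub by (intro Z2_boundary_eq_sum[OF fin]) (auto simp: Z2_chain_group_iff[OF X])
      also have "\<dots> = c \<tau> + (\<Sum>w\<in>V - \<tau>. c (insert w ?\<rho>))"
        unfolding V using True fin insert_Diff[OF True] by (subst sum.insert) simp_all
      finally have "c \<tau> + (\<Sum>w\<in>V - \<tau>. c (insert w ?\<rho>)) = 0"
        unfolding cyc by (rule sym)
      then have "(\<Sum>w\<in>V - \<tau>. c (insert w ?\<rho>)) = c \<tau>"
        by (metis bit_add_eq_0_iff)
      moreover have "d (insert w \<tau>) = c (insert w ?\<rho>)" if "w \<in> V - \<tau>" for w
      proof -
        have "insert w \<tau> - {v} = insert w ?\<rho>" using that True by auto
        then show ?thesis using True by (simp add: d_def)
      qed
      ultimately show ?thesis by simp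
    qed
    finally show ?thesis .
  qed
  with d show "\<exists>d\<in>carrier (Z2_chain_group X (i + 1)). Z2_boundary d = c" by blast
qed

lemma acyclic_in_dim_no_faces:
  assumes X: "simplicial_complex_on V X" and "\<And>\<sigma>. \<sigma> \<in> X \<Longrightarrow> int (card \<sigma>) \<noteq> i + 1"
  shows "acyclic_in_dim X i"
proof (rule acyclic_in_dimI)
  fix c assume "c \<in> carrier (Z2_chain_group X i)"
  then have "c = (\<lambda>_. 0)"
    using assms(2) unfolding Z2_chain_group_iff[OF X] by blast
  then show "\<exists>d\<in>carrier (Z2_chain_group X (i + 1)). Z2_boundary d = c"
    by (intro bexI[of _ "\<lambda>_. 0"]) (auto simp: Z2_chain_group_iff[OF X] Z2_boundary_def)
qed

text \<open>Exactness of the Mayer-Vietoris sequence at the homology of the union, carried out on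
  chains.\<close>

lemma acyclic_in_dim_Un:
  assumes X: "simplicial_complex_on V X" and Y: "simplicial_complex_on V Y"
    and "acyclic_in_dim X i" "acyclic_in_dim Y i" "acyclic_in_dim (X \<inter> Y) (i - 1)"
  shows "acyclic_in_dim (X \<union> Y) i"
proof (rule acyclic_in_dimI)
  have fin: "finite V" using X by (simp add: simplicial_complex_on_def)
  have down: "\<tau> \<in> X" if "\<sigma> \<in> X" "\<tau> \<subseteq> \<sigma>" for \<sigma> \<tau>
    using X that by (simp add: simplicial_complex_on_def)
  have down': "\<tau> \<in> Y" if "\<sigma> \<in> Y" "\<tau> \<subseteq> \<sigma>" for \<sigma> \<tau>
    using Y that by (simp add: simplicial_complex_on_def)
  have XY: "simplicial_complex_on V (X \<union> Y)" and XnY: "simplicial_complex_on V (X \<inter> Y)"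
    using X Y by (auto simp: simplicial_complex_on_def intro: down down')
  note iff = Z2_chain_group_iff[OF XY] Z2_chain_group_iff[OF XnY]
    Z2_chain_group_iff[OF X] Z2_chain_group_iff[OF Y]
  have add: "Z2_boundary (\<lambda>\<sigma>. a \<sigma> + b \<sigma>) = (\<lambda>\<tau>. Z2_boundary a \<tau> + Z2_boundary b \<tau>)"
    if "a \<in> carrier (Z2_chain_group (X \<union> Y) k)" "b \<in> carrier (Z2_chain_group (X \<union> Y) l)" for a b k l
    using Z2_boundary_add[OF fin Z2_chain_support[OF XY that(1)] Z2_chain_support[OF XY that(2)]] .
  note inX = Z2_chain_group_mono[OF Un_upper1[of X Y]] and inY = Z2_chain_group_mono[OF Un_upper2[of Y X]]
  fix c assume c: "c \<in> carrier (Z2_chain_group (X \<union> Y) i)" and cyc: "Z2_boundary c = (\<lambda>_. 0)"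
  \<comment> \<open>Faces of \<open>c\<close> outside \<open>X\<close> lie in \<open>Y\<close>, so
    \<open>c\<close> splits into a chain of \<open>X\<close> and a chain of
    \<open>Y\<close>.\<close>
  define a where "a \<sigma> = (if \<sigma> \<in> X then c \<sigma> else 0)" for \<sigma>
  define b where "b \<sigma> = (if \<sigma> \<in> X then 0 else c \<sigma>)" for \<sigma>
  have a: "a \<in> carrier (Z2_chain_group X i)" and b: "b \<in> carrier (Z2_chain_group Y i)"
    using c by (auto simp: iff a_def b_def)
  have c_eq: "c = (\<lambda>\<sigma>. a \<sigma> + b \<sigma>)"
    by (auto simp: a_def b_def)
  have "(\<lambda>\<tau>. Z2_boundary a \<tau> + Z2_boundary b \<tau>) = (\<lambda>_. 0)"
    using add[OF inX[OF a] inY[OF b]] cyc unfolding c_eq by simp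
  then have ab: "Z2_boundary a = Z2_boundary b"
    by (simp add: fun_eq_iff)
  \<comment> \<open>The two pieces share their boundary, which is therefore supported in the
    intersection and is a cycle there.\<close>
  have "Z2_boundary a \<in> carrier (Z2_chain_group (X \<inter> Y) (i - 1))"
    using Z2_boundary_chain[OF X a] Z2_boundary_chain[OF Y b] unfolding iff ab by blast
  moreover have "Z2_boundary (Z2_boundary a) = (\<lambda>_. 0)"
    using Z2_boundary_boundary[OF fin Z2_chain_support[OF X a]] .
  ultimately obtain w where w: "w \<in> carrier (Z2_chain_group (X \<inter> Y) i)" "Z2_boundary w = Z2_boundary a"
    using acyclic_in_dimE[OF assms(5)] by (metis diff_add_cancel)
  have wX: "w \<in> carrier (Z2_chain_group X i)" and wY: "w \<in> carrier (Z2_chain_group Y i)"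
    using w(1) by (auto intro: Z2_chain_group_mono[rotated])
  \<comment> \<open>Correcting both pieces by \<open>w\<close> turns them into cycles of
    \<open>X\<close> and of \<open>Y\<close>. The two copies of \<open>w\<close> cancel when the
    fillings \<open>p\<close> and \<open>q\<close> are added.\<close>
  have "Z2_boundary (\<lambda>\<sigma>. a \<sigma> + w \<sigma>) = (\<lambda>_. 0)"
    using add[OF inX[OF a] inX[OF wX]] w(2) by simp
  then obtain p where p: "p \<in> carrier (Z2_chain_group X (i + 1))" "Z2_boundary p = (\<lambda>\<sigma>. a \<sigma> + w \<sigma>)"
    by (rule acyclic_in_dimE[OF assms(3) Z2_chain_group_add[OF X a wX]])
  have "Z2_boundary (\<lambda>\<sigma>. b \<sigma> + w \<sigma>) = (\<lambda>_. 0)"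
    using add[OF inY[OF b] inX[OF wX]] w(2) ab by simp
  then obtain q where q: "q \<in> carrier (Z2_chain_group Y (i + 1))" "Z2_boundary q = (\<lambda>\<sigma>. b \<sigma> + w \<sigma>)"
    by (rule acyclic_in_dimE[OF assms(4) Z2_chain_group_add[OF Y b wY]])
  have "Z2_boundary (\<lambda>\<sigma>. p \<sigma> + q \<sigma>) = (\<lambda>\<sigma>. a \<sigma> + w \<sigma> + (b \<sigma> + w \<sigma>))"
    using add[OF inX[OF p(1)] inY[OF q(1)]] by (simp only: p(2) q(2))
  also have "\<dots> = c"
  proof
    fix \<sigma>
    have "a \<sigma> + w \<sigma> + (b \<sigma> + w \<sigma>) = a \<sigma> + b \<sigma> + (w \<sigma> + w \<sigma>)" by (simp only: ac_simps)
    then show "a \<sigma> + w \<sigma> + (b \<sigma> + w \<sigma>) = c \<sigma>" by (simp only: c_eq bit_add_self add_0_right)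
  qed
  finally have "Z2_boundary (\<lambda>\<sigma>. p \<sigma> + q \<sigma>) = c" .
  moreover have "(\<lambda>\<sigma>. p \<sigma> + q \<sigma>) \<in> carrier (Z2_chain_group (X \<union> Y) (i + 1))"
    using Z2_chain_group_add[OF XY inX[OF p(1)] inY[OF q(1)]] .
  ultimately show "\<exists>d\<in>carrier (Z2_chain_group (X \<union> Y) (i + 1)). Z2_boundary d = c" by blast
qed

section \<open>Noncover complexes under deletion and contraction of an edge\<close>

text \<open>The edge \<open>e\<close> is taken out first because \<open>e - e\<close> would be an
  empty edge. Edges that agree outside \<open>e\<close> become one.\<close>

definition contract_edge :: "'a set \<Rightarrow> 'a set set \<Rightarrow> 'a set set" where
  "contract_edge e H = (\<lambda>f. f - e) ` (H - {e})"

lemma hypergraph_finite_edges: "hypergraph V H \<Longrightarrow> finite H"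
  by (rule finite_subset[of H "Pow V"]) (auto simp: hypergraph_def)

lemma hypergraph_delete: "hypergraph V H \<Longrightarrow> hypergraph V (H - {e})"
  by (simp add: hypergraph_def)

text \<open>An edge other than \<open>e\<close> can shrink to the empty set only if it lies properly
  inside \<open>e\<close>.\<close>

lemma hypergraph_contract:
  assumes "hypergraph V H" and "\<And>f. f \<in> H \<Longrightarrow> \<not> f \<subset> e"
  shows "hypergraph (V - e) (contract_edge e H)"
  using assms unfolding hypergraph_def contract_edge_def by blast

lemma card_contract_edge_less:
  assumes "finite H" "e \<in> H"
  shows "card (contract_edge e H) < card H"
proof -
  have "card (contract_edge e H) \<le> card (H - {e})"
    unfolding contract_edge_def using assms by (intro card_image_le) simp
  also have "\<dots> < card H"
    using assms by (rule card_Diff1_less)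
  finally show ?thesis .
qed

lemma noncover_complex_iff:
  "W \<in> noncover_complex V H \<longleftrightarrow> W \<subseteq> V \<and> (\<exists>e\<in>H. W \<inter> e = {})"
  by (auto simp: noncover_complex_def cover_def)

lemma simplicial_complex_on_noncover_complex:
  "finite V \<Longrightarrow> simplicial_complex_on V (noncover_complex V H)"
  unfolding simplicial_complex_on_def Ball_def noncover_complex_iff by blast

lemma noncover_complex_delete_nonminimal:
  assumes "f \<in> H" "f \<subset> e"
  shows "noncover_complex V (H - {e}) = noncover_complex V H"
proof (rule Set.set_eqI)
  fix W
  have "f \<in> H - {e}" and "W \<inter> e = {} \<Longrightarrow> W \<inter> f = {}"
    using assms by blast+
  then show "W \<in> noncover_complex V (H - {e}) \<longleftrightarrow> W \<in> noncover_complex V H"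
    unfolding noncover_complex_iff by (metis DiffE DiffI singletonD)
qed

lemma noncover_complex_delete_Un:
  assumes "e \<in> H"
  shows "noncover_complex V H = noncover_complex V (H - {e}) \<union> Pow (V - e)"
proof (rule Set.set_eqI)
  fix W
  have "W \<in> Pow (V - e) \<longleftrightarrow> W \<subseteq> V \<and> W \<inter> e = {}"
    by blast
  then show "W \<in> noncover_complex V H \<longleftrightarrow> W \<in> noncover_complex V (H - {e}) \<union> Pow (V - e)"
    using assms unfolding Un_iff noncover_complex_iff by (metis DiffE DiffI singletonD)
qed

text \<open>A set disjoint from \<open>e\<close> misses \<open>f\<close> exactly when it misses
  \<open>f - e\<close>.\<close>

lemma noncover_complex_delete_Int:
  "noncover_complex V (H - {e}) \<inter> Pow (V - e) = noncover_complex (V - e) (contract_edge e H)"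
proof (rule Set.set_eqI)
  fix W
  have "W \<inter> f = {} \<longleftrightarrow> W \<inter> (f - e) = {}" if "W \<subseteq> V - e" for f
    using that by blast
  then show "W \<in> noncover_complex V (H - {e}) \<inter> Pow (V - e)
    \<longleftrightarrow> W \<in> noncover_complex (V - e) (contract_edge e H)"
    by (auto simp: noncover_complex_iff contract_edge_def)
qed

text \<open>Adding a vertex that lies in no edge to a noncover leaves the same edge missed.\<close>

lemma acyclic_in_dim_isolated_vertex:
  assumes "finite V" "has_isolated_vertex V H"
  shows "acyclic_in_dim (noncover_complex V H) i"
proof -
  obtain v where v: "v \<in> V" "\<And>e. e \<in> H \<Longrightarrow> v \<notin> e"
    using assms(2) by (auto simp: has_isolated_vertex_def)
  show ?thesis
    using simplicial_complex_on_noncover_complex[OF assms(1)] v(1)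
    by (rule acyclic_in_dim_cone) (use v in \<open>auto simp: noncover_complex_iff\<close>)
qed

text \<open>The missed edge is non-empty, so its vertices are left out. Hence faces have dimension
  at most \<open>card V - 2\<close>.\<close>

lemma noncover_card_less:
  assumes "hypergraph V H" "W \<in> noncover_complex V H"
  shows "card W < card V"
proof -
  obtain e where "W \<subseteq> V" "e \<in> H" "W \<inter> e = {}"
    using assms(2) by (auto simp: noncover_complex_iff)
  moreover from this have "e \<noteq> {}" "e \<subseteq> V" "finite V"
    using assms(1) by (auto simp: hypergraph_def)
  ultimately show ?thesis
    by (intro psubset_card_mono) auto
qed

text \<open>A vertex of \<open>V - e\<close> serves as apex of the full simplex on
  \<open>V - e\<close>. For \<open>V = e\<close> that simplex would be \<open>{{}}\<close>, which
  has homology in degree -1.\<close>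

lemma acyclic_in_dim_edge:
  assumes fin: "finite V" and e: "e \<in> H" and "V - e \<noteq> {}"
    and "acyclic_in_dim (noncover_complex V (H - {e})) i"
    and "acyclic_in_dim (noncover_complex (V - e) (contract_edge e H)) (i - 1)"
  shows "acyclic_in_dim (noncover_complex V H) i"
proof -
  obtain v where v: "v \<in> V - e" using \<open>V - e \<noteq> {}\<close> by blast
  have simplex: "simplicial_complex_on V (Pow (V - e))"
    using fin unfolding simplicial_complex_on_def by blast
  have "acyclic_in_dim (Pow (V - e)) i"
    using v by (intro acyclic_in_dim_cone[OF simplex, of v]) auto
  then show ?thesis
    unfolding noncover_complex_delete_Un[OF e]
    using assms(4,5) simplex simplicial_complex_on_noncover_complex[OF fin]
    by (intro acyclic_in_dim_Un) (auto simp: noncover_complex_delete_Int)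
qed

text \<open>
  Contracting an edge \<open>e\<close> lowers the degree by \<open>1\<close> and the number of vertices by \<open>card e\<close>, so a
  parameter \<open>m\<close> bounds the vanishing range as soon as some contraction loses at most
  \<open>card e - 1\<close> and the corresponding deletion loses nothing.
\<close>

lemma acyclic_noncover_complex_induct:
  fixes P :: "'a set \<Rightarrow> 'a set set \<Rightarrow> int \<Rightarrow> bool"
  assumes step: "\<And>V H m. hypergraph V H \<Longrightarrow> \<not> has_isolated_vertex V H \<Longrightarrow> P V H m \<Longrightarrow> 0 < m \<Longrightarrow>
      \<exists>e\<in>H. P V (H - {e}) m \<and> P (V - e) (contract_edge e H) (m - int (card e) + 1)"
    and "hypergraph V H" "P V H m" "i \<ge> int (card V) - m - 1"
  shows "acyclic_in_dim (noncover_complex V H) i"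
  using assms(2-)
proof (induction "card H" arbitrary: V H m i rule: less_induct)
  case less
  note H = less.prems(1)
  have fin: "finite V" "finite H"
    using H hypergraph_finite_edges by (auto simp: hypergraph_def)
  note complex = simplicial_complex_on_noncover_complex[OF fin(1)]
  consider "has_isolated_vertex V H" | "m \<le> 0" | "\<not> has_isolated_vertex V H" "0 < m" by linarith
  then show ?case
  proof cases
    case 1
    then show ?thesis by (rule acyclic_in_dim_isolated_vertex[OF fin(1)])
  next
    case 2
    show ?thesis
    proof (rule acyclic_in_dim_no_faces[OF complex])
      fix W assume "W \<in> noncover_complex V H"
      then have "card W < card V" by (rule noncover_card_less[OF H])
      \<comment> \<open>Here \<open>i\<close> is at least \<open>card V - 1\<close>, above the
        dimension of every face.\<close>
      then show "int (card W) \<noteq> i + 1"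
        using 2 less.prems(3) by linarith
    qed
  next
    case 3
    obtain e where e: "e \<in> H" "P V (H - {e}) m"
      "P (V - e) (contract_edge e H) (m - int (card e) + 1)"
      using step[OF H 3(1) less.prems(2) 3(2)] by blast
    have del: "acyclic_in_dim (noncover_complex V (H - {e})) i"
      using card_Diff1_less[OF fin(2) e(1)] hypergraph_delete[OF H] e(2) less.prems(3)
      by (rule less.hyps)
    have "e \<subseteq> V" using H e(1) by (auto simp: hypergraph_def)
    then have card: "int (card (V - e)) = int (card V) - int (card e)"
      using fin(1) card_mono[of V e] by (simp add: card_Diff_subset finite_subset of_nat_diff)
    show ?thesis
    proof (cases "\<exists>f\<in>H. f \<subset> e")
      case True
      then show ?thesis using del noncover_complex_delete_nonminimal by metis
    next
      case False
      then have contr: "hypergraph (V - e) (contract_edge e H)"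
        by (intro hypergraph_contract[OF H]) blast
      show ?thesis
      proof (cases "V - e = {}")
        case True
        \<comment> \<open>The contraction has no edge that \<open>step\<close> could return, so its
          parameter is at most 0. This forces \<open>i \<ge> 0\<close>, while the only face of the
          noncover complex is the empty one, in degree -1.\<close>
        then have "contract_edge e H = {}" "V = e"
          using contr \<open>e \<subseteq> V\<close> by (auto simp: hypergraph_def)
        have "\<not> has_isolated_vertex (V - e) (contract_edge e H)"
          unfolding True has_isolated_vertex_def by simp
        then have "m - int (card e) + 1 \<le> 0"
          using step[OF contr _ e(3)] \<open>contract_edge e H = {}\<close> by force
        then have "i \<ge> 0" using less.prems(3) \<open>V = e\<close> by simp
        have "W = {}" if "W \<in> noncover_complex V H" for W
          using that \<open>contract_edge e H = {}\<close> \<open>V = e\<close> unfolding noncover_complex_iff contract_edge_def by blast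
        then show ?thesis
          using \<open>i \<ge> 0\<close> by (intro acyclic_in_dim_no_faces[OF complex]) force
      next
        case nonempty: False
        have "acyclic_in_dim (noncover_complex (V - e) (contract_edge e H)) (i - 1)"
          using card_contract_edge_less[OF fin(2) e(1)] contr e(3)
          by (rule less.hyps) (use less.prems(3) card in simp)
        then show ?thesis
          by (rule acyclic_in_dim_edge[OF fin(1) e(1) nonempty del])
      qed
    qed
  qed
qed

section \<open>Domination and the three parameters\<close>

text \<open>The set \<open>W'\<close> in the definition can only be \<open>e - {v}\<close> for an
  edge \<open>e\<close> through \<open>v\<close>.\<close>

lemma dominates_vertex_iff:
  "dominates_vertex H W v \<longleftrightarrow> (\<exists>e\<in>H. v \<in> e \<and> e - {v} \<subseteq> W)"
proof
  assume "dominates_vertex H W v"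
  then obtain W' where "W' \<subseteq> W - {v}" "W' \<union> {v} \<in> H"
    by (auto simp: dominates_vertex_def)
  then show "\<exists>e\<in>H. v \<in> e \<and> e - {v} \<subseteq> W"
    by (intro bexI[of _ "W' \<union> {v}"]) auto
next
  assume "\<exists>e\<in>H. v \<in> e \<and> e - {v} \<subseteq> W"
  then obtain e where "e \<in> H" "v \<in> e" "e - {v} \<subseteq> W" by blast
  then show "dominates_vertex H W v"
    unfolding dominates_vertex_def
    by (intro exI[of _ "e - {v}"]) (auto simp: insert_absorb)
qed

lemma dominates_iff:
  "dominates H W A \<longleftrightarrow> (\<forall>v\<in>A. \<exists>e\<in>H. v \<in> e \<and> e - {v} \<subseteq> W)"
  by (simp add: dominates_def dominates_vertex_iff)

lemma dominates_mono:
  "dominates H W A \<Longrightarrow> H \<subseteq> H' \<Longrightarrow> W \<subseteq> W' \<Longrightarrow> dominates H' W' A"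
  unfolding dominates_iff by (meson order_trans subsetD)

text \<open>Lifts domination from the contraction. A vertex outside \<open>e\<close> uses an
  original of its contracted edge, whose part in \<open>e\<close> must lie in \<open>W'\<close>; a
  vertex of \<open>A\<close> in \<open>e\<close> uses \<open>e\<close> itself. The three parameters
  differ in how cheaply \<open>W'\<close> can be chosen.\<close>

lemma dominates_contract_edge:
  assumes dom: "dominates (contract_edge e H) W (A - e)" and "e \<in> H"
    and ext: "\<And>f v. f \<in> H \<Longrightarrow> v \<in> A - e \<Longrightarrow> v \<in> f \<Longrightarrow> f \<inter> e \<subseteq> W'"
    and self: "\<And>v. v \<in> A \<inter> e \<Longrightarrow> e - {v} \<subseteq> W'"
    and "W \<subseteq> W'"
  shows "dominates H W' A"
  unfolding dominates_iff
proof
  fix v assume "v \<in> A"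
  show "\<exists>f\<in>H. v \<in> f \<and> f - {v} \<subseteq> W'"
  proof (cases "v \<in> e")
    case True
    then show ?thesis using self \<open>v \<in> A\<close> \<open>e \<in> H\<close> by blast
  next
    case False
    then obtain f where f: "f \<in> H" "v \<in> f" "f - e - {v} \<subseteq> W"
      using dom \<open>v \<in> A\<close> unfolding dominates_iff contract_edge_def by blast
    moreover have "f \<inter> e \<subseteq> W'"
      using ext[OF f(1) _ f(2)] \<open>v \<in> A\<close> False by blast
    ultimately show ?thesis using \<open>W \<subseteq> W'\<close> by blast
  qed
qed

text \<open>If all edges through \<open>A\<close> are loops, the empty set dominates \<open>A\<close>.\<close>

lemma exists_nonloop_edge:
  assumes "hypergraph V H" "\<not> has_isolated_vertex V H" "A \<subseteq> V" "\<not> dominates H {} A"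
  obtains e where "e \<in> H" "e \<inter> A \<noteq> {}" "card e \<ge> 2"
proof -
  obtain v where v: "v \<in> A" "\<And>e. e \<in> H \<Longrightarrow> v \<in> e \<Longrightarrow> e - {v} \<noteq> {}"
    using assms(4) unfolding dominates_iff subset_empty by metis
  obtain e where e: "e \<in> H" "v \<in> e"
    using assms(2,3) v(1) unfolding has_isolated_vertex_def by blast
  have "finite e"
    using assms(1) e(1) unfolding hypergraph_def by (meson finite_subset)
  obtain w where w: "w \<in> e" "w \<noteq> v" using v(2)[OF e] by blast
  then have "{v, w} \<subseteq> e" using e(2) by simp
  then have "card {v, w} \<le> card e" by (rule card_mono[OF \<open>finite e\<close>])
  moreover have "card {v, w} = 2" using w(2) by simp
  moreover have "e \<inter> A \<noteq> {}" using e(2) v(1) by blast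
  ultimately show thesis using that[OF e(1)] by simp
qed

section \<open>The vanishing range for each parameter\<close>

text \<open>The inequality on \<open>m\<close> says
  \<open>m \<le> \<lceil>card W / 2\<rceil>\<close>. Lifting may cost all \<open>card e\<close>
  vertices of \<open>e\<close>, and \<open>card e \<le> 2 * (card e - 1)\<close> for a non-loop;
  this is where the factor one half comes from.\<close>

lemma acyclic_gamma_tilde:
  assumes "hypergraph V H"
    and "\<And>W. W \<subseteq> V \<Longrightarrow> dominates H W V \<Longrightarrow> 2 * m \<le> int (card W) + 1"
    and "i \<ge> int (card V) - m - 1"
  shows "acyclic_in_dim (noncover_complex V H) i"
proof (rule acyclic_noncover_complex_induct[where m = m and
      P = "\<lambda>V H m. \<forall>W. W \<subseteq> V \<longrightarrow> dominates H W V \<longrightarrow> 2 * m \<le> int (card W) + 1"])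
  fix V :: "'a set" and H m
  assume H: "hypergraph V H" "\<not> has_isolated_vertex V H" and "0 < m"
    and P: "\<forall>W. W \<subseteq> V \<longrightarrow> dominates H W V \<longrightarrow> 2 * m \<le> int (card W) + 1"
  have "\<not> dominates H {} V" using P \<open>0 < m\<close> by force
  then obtain e where e: "e \<in> H" "card e \<ge> 2"
    using exists_nonloop_edge[OF H] by blast
  have "2 * (m - int (card e) + 1) \<le> int (card W) + 1"
    if W: "W \<subseteq> V - e" "dominates (contract_edge e H) W (V - e)" for W
  proof -
    have "dominates H (W \<union> e) V"
      using W(2) e(1) by (rule dominates_contract_edge) auto
    moreover have "W \<union> e \<subseteq> V" using W(1) e(1) H(1) by (auto simp: hypergraph_def)
    ultimately have "2 * m \<le> int (card (W \<union> e)) + 1" using P by blast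
    moreover have "int (card (W \<union> e)) \<le> int (card W) + int (card e)"
      by (metis card_Un_le of_nat_add of_nat_le_iff)
    moreover have "2 \<le> int (card e)" using e(2) by simp
    ultimately show ?thesis by presburger
  qed
  moreover have "\<forall>W. W \<subseteq> V \<longrightarrow> dominates (H - {e}) W V \<longrightarrow> 2 * m \<le> int (card W) + 1"
    using P dominates_mono[of "H - {e}" _ V H] by blast
  ultimately show "\<exists>e\<in>H. (\<forall>W. W \<subseteq> V \<longrightarrow> dominates (H - {e}) W V \<longrightarrow> 2 * m \<le> int (card W) + 1) \<and>
      (\<forall>W. W \<subseteq> V - e \<longrightarrow> dominates (contract_edge e H) W (V - e) \<longrightarrow>
        2 * (m - int (card e) + 1) \<le> int (card W) + 1)"
    using e(1) by blast
qed (use assms in simp_all)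

text \<open>Contract an edge \<open>e\<close> that meets \<open>A\<close>, necessarily in a single
  vertex \<open>a\<close>. An edge through another vertex of \<open>A\<close> avoids
  \<open>a\<close>, so adding \<open>e - {a}\<close> is enough and costs at most
  \<open>card e - 1\<close>.\<close>

lemma acyclic_gamma_si:
  assumes "hypergraph V H" "A \<subseteq> V" "\<And>e. e \<in> H \<Longrightarrow> card (e \<inter> A) \<le> 1"
    and "\<And>W. W \<subseteq> V \<Longrightarrow> dominates H W A \<Longrightarrow> m \<le> int (card W)"
    and "i \<ge> int (card V) - m - 1"
  shows "acyclic_in_dim (noncover_complex V H) i"
proof -
  \<comment> \<open>\<open>A\<close> may contain loops: contracting \<open>e\<close> turns \<open>f\<close> with \<open>f - e = {v}\<close> into one.\<close>
  define P where "P V H m \<longleftrightarrow> (\<exists>A\<subseteq>V. (\<forall>e\<in>H. card (e \<inter> A) \<le> 1) \<and>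
      (\<forall>W. W \<subseteq> V \<longrightarrow> dominates H W A \<longrightarrow> m \<le> int (card W)))" for V :: "'a set" and H m
  show ?thesis
  proof (rule acyclic_noncover_complex_induct[where P = P and m = m])
    fix V :: "'a set" and H m
    assume H: "hypergraph V H" "\<not> has_isolated_vertex V H" and "0 < m" and "P V H m"
    then obtain A where A: "A \<subseteq> V" "\<And>e. e \<in> H \<Longrightarrow> card (e \<inter> A) \<le> 1"
      and dom: "\<And>W. W \<subseteq> V \<Longrightarrow> dominates H W A \<Longrightarrow> m \<le> int (card W)"
      unfolding P_def by blast
    have fin: "finite f" if "f \<in> H" for f
      using that H(1) by (auto simp: hypergraph_def intro: finite_subset)
    have uniq: "v = w" if "f \<in> H" "v \<in> f" "v \<in> A" "w \<in> f" "w \<in> A" for f v w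
      using A(2)[OF that(1)] fin[OF that(1)] that card_le_Suc0_iff_eq[of "f \<inter> A"] by auto
    have "\<not> dominates H {} A" using dom[of "{}"] \<open>0 < m\<close> by force
    then obtain e where e: "e \<in> H" "e \<inter> A \<noteq> {}"
      using exists_nonloop_edge[OF H A(1)] by blast
    then obtain a where a: "a \<in> e" "a \<in> A" by blast
    have "m - int (card e) + 1 \<le> int (card W)"
      if W: "W \<subseteq> V - e" "dominates (contract_edge e H) W (A - e)" for W
    proof -
      have "dominates H (W \<union> (e - {a})) A"
        using W(2) e(1)
      proof (rule dominates_contract_edge)
        show "f \<inter> e \<subseteq> W \<union> (e - {a})" if "f \<in> H" "v \<in> A - e" "v \<in> f" for f v
          using uniq[of f v a] that a by blast
        show "e - {v} \<subseteq> W \<union> (e - {a})" if "v \<in> A \<inter> e" for v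
          using uniq[OF e(1), of v a] that a by blast
      qed simp
      moreover have "W \<union> (e - {a}) \<subseteq> V" using W(1) e(1) H(1) by (auto simp: hypergraph_def)
      ultimately have "m \<le> int (card (W \<union> (e - {a})))" by (intro dom)
      moreover have "card (W \<union> (e - {a})) \<le> card W + card (e - {a})" by (rule card_Un_le)
      moreover have "Suc (card (e - {a})) = card e" using fin[OF e(1)] a(1) by (rule card_Suc_Diff1)
      ultimately show ?thesis by linarith
    qed
    moreover have "card ((f - e) \<inter> (A - e)) \<le> 1" if "f \<in> H" for f
      using A(2)[OF that] fin[OF that] card_mono[of "f \<inter> A" "(f - e) \<inter> (A - e)"] by force
    moreover have "A - e \<subseteq> V - e" using A(1) by blast
    ultimately have "P (V - e) (contract_edge e H) (m - int (card e) + 1)"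
      unfolding P_def by (intro exI[of _ "A - e"]) (auto simp: contract_edge_def)
    moreover have "P V (H - {e}) m"
      unfolding P_def using A dom dominates_mono[of "H - {e}" _ A H] by (intro exI[of _ A]) blast
    ultimately show "\<exists>e\<in>H. P V (H - {e}) m \<and> P (V - e) (contract_edge e H) (m - int (card e) + 1)"
      using e(1) by blast
  next
    show "P V H m"
      unfolding P_def using assms(2-4) by blast
  qed fact+
qed

text \<open>Lifting a family edge by edge and adding \<open>e\<close>, which supplies all missing
  vertices, enlarges it by at most 1, and this is at most \<open>card e - 1\<close> for a
  non-loop.\<close>

lemma acyclic_gamma_E:
  assumes "hypergraph V H"
    and "\<And>F. F \<subseteq> H \<Longrightarrow> dominates H (\<Union>F) V \<Longrightarrow> m \<le> int (card F)"
    and "i \<ge> int (card V) - m - 1"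
  shows "acyclic_in_dim (noncover_complex V H) i"
proof (rule acyclic_noncover_complex_induct[where m = m and
      P = "\<lambda>V H m. \<forall>F. F \<subseteq> H \<longrightarrow> dominates H (\<Union>F) V \<longrightarrow> m \<le> int (card F)"])
  fix V :: "'a set" and H m
  assume H: "hypergraph V H" "\<not> has_isolated_vertex V H" and "0 < m"
    and P: "\<forall>F. F \<subseteq> H \<longrightarrow> dominates H (\<Union>F) V \<longrightarrow> m \<le> int (card F)"
  have "\<not> dominates H {} V" using P[rule_format, of "{}"] \<open>0 < m\<close> by force
  then obtain e where e: "e \<in> H" "card e \<ge> 2"
    using exists_nonloop_edge[OF H] by blast
  have "m - int (card e) + 1 \<le> int (card F)"
    if F: "F \<subseteq> contract_edge e H" "dominates (contract_edge e H) (\<Union>F) (V - e)" for F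
  proof -
    \<comment> \<open>One original is chosen for each contracted edge, so the family keeps its
      size.\<close>
    obtain G where G: "G \<subseteq> H - {e}" "inj_on (\<lambda>f. f - e) G" "F = (\<lambda>f. f - e) ` G"
      using F(1) unfolding contract_edge_def subset_image_inj by blast
    have "dominates H (\<Union>(insert e G)) V"
      using F(2) e(1) by (rule dominates_contract_edge) (auto simp: G(3))
    then have "m \<le> int (card (insert e G))" using P G(1) e(1) by blast
    also have "\<dots> \<le> int (card G) + 1"
      using card_insert_le_m1[of "Suc (card G)" G e] by simp
    also have "card G = card F" using G(2,3) by (simp add: card_image)
    finally show ?thesis using e(2) by linarith
  qed
  moreover have "\<forall>F. F \<subseteq> H - {e} \<longrightarrow> dominates (H - {e}) (\<Union>F) V \<longrightarrow> m \<le> int (card F)"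
    using P dominates_mono[of "H - {e}" _ V H] by blast
  ultimately show "\<exists>e\<in>H. (\<forall>F. F \<subseteq> H - {e} \<longrightarrow> dominates (H - {e}) (\<Union>F) V \<longrightarrow> m \<le> int (card F)) \<and>
      (\<forall>F. F \<subseteq> contract_edge e H \<longrightarrow> dominates (contract_edge e H) (\<Union>F) (V - e) \<longrightarrow>
        m - int (card e) + 1 \<le> int (card F))"
    using e(1) by blast
qed (use assms in simp_all)

section \<open>From extended values to integer bounds\<close>

lemma ereal_of_int_le_enat_INF:
  assumes "ereal (of_int m) \<le> ereal_of_enat (INF x\<in>S. enat (f x))" "x \<in> S"
  shows "m \<le> int (f x)"
proof -
  have "(INF x\<in>S. enat (f x)) \<le> enat (f x)" using assms(2) by (rule INF_lower)
  then have "ereal_of_enat (INF x\<in>S. enat (f x)) \<le> ereal_of_enat (enat (f x))"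
    by (simp only: ereal_of_enat_le_iff)
  with assms(1) have "ereal (of_int m) \<le> ereal (real (f x))"
    by (metis ereal_of_enat_simps(1) order_trans)
  then show ?thesis by simp
qed

theorem theorem1p4:
  fixes V :: "'a set" and H :: "'a set set" and i :: int
  assumes "hypergraph V H"
    and "ereal (of_int i) \<ge>
           ereal (of_nat (card V))
           - ereal_of_enat (max (ceil_half (gamma_tilde V H)) (max (gamma_si V H) (gamma_E V H)))
           - 1"
  shows "trivial_group (Z2_reduced_homology (noncover_complex V H) i)"
proof -
  note H = assms(1)
  have fin: "finite V" using H by (simp add: hypergraph_def)
  \<comment> \<open>With this \<open>m\<close> the degree \<open>i\<close> sits exactly at the
    threshold, and the assumption becomes a lower bound \<open>m\<close> for the maximum of the
    parameters.\<close>
  define m where "m = int (card V) - 1 - i"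
  have i: "i \<ge> int (card V) - m - 1" by (simp add: m_def)
  have m_le: "ereal (of_int m) \<le> ereal_of_enat x"
    if "ereal (of_int i) \<ge> ereal (of_nat (card V)) - ereal_of_enat x - 1" for x
    using that by (cases x) (auto simp: m_def one_ereal_def)
  have "acyclic_in_dim (noncover_complex V H) i"
  \<comment> \<open>An isolated vertex makes all parameters infinite, so it is split off before
    their defining infima and suprema are used.\<close>
  proof (cases "has_isolated_vertex V H")
    case True
    then show ?thesis by (rule acyclic_in_dim_isolated_vertex[OF fin])
  next
    case False
    consider "ereal (of_int m) \<le> ereal_of_enat (ceil_half (gamma_tilde V H))"
      | "ereal (of_int m) \<le> ereal_of_enat (gamma_si V H)"
      | "ereal (of_int m) \<le> ereal_of_enat (gamma_E V H)"
      using m_le[OF assms(2)] by (auto simp: max_def split: if_splits)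
    then show ?thesis
    proof cases
      case 1
      have "2 * m \<le> int (card W) + 1" if W: "W \<subseteq> V" "dominates H W V" for W
      proof -
        \<comment> \<open>A dominating set makes the parameter finite, so \<open>ceil_half\<close>
          can be evaluated.\<close>
        have "gamma_tilde V H \<le> enat (card W)"
          using W False unfolding gamma_tilde_def gamma_def by (auto intro: INF_lower)
        then obtain n where n: "gamma_tilde V H = enat n" "n \<le> card W"
          by (cases "gamma_tilde V H") auto
        then have "m \<le> \<lceil>real n / 2\<rceil>"
          using 1 by (simp add: ceil_half_def)
        with n(2) show ?thesis by linarith
      qed
      then show ?thesis using i by (rule acyclic_gamma_tilde[OF H])
    next
      case 2
      \<comment> \<open>One set reaching \<open>m\<close> is extracted from the supremum. For
        \<open>m > 0\<close> some value exceeds \<open>m - 1\<close>, hence is at least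
        \<open>m\<close> by integrality. For \<open>m \<le> 0\<close> the empty set serves; it is
        independent because edges are non-empty.\<close>
      have "\<exists>A. strongly_independent V H A \<and> ereal (of_int m) \<le> ereal_of_enat (gamma V H A)"
      proof (cases "m \<le> 0")
        case True
        have "strongly_independent V H {}"
          using H by (auto simp: strongly_independent_def independent_set_def hypergraph_def)
        moreover have "ereal (of_int m) \<le> ereal_of_enat (gamma V H {})"
          by (rule order_trans[OF _ ereal_of_enat_nonneg]) (use True in simp)
        ultimately show ?thesis by blast
      next
        case False
        then have m: "real_of_int m = real (nat m)" by simp
        have "enat (nat m) \<le> gamma_si V H"
          using 2 unfolding m ereal_of_enat_simps(1)[symmetric] by (simp only: ereal_of_enat_le_iff)
        moreover have "enat (nat m - 1) < enat (nat m)" using False by simp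
        ultimately have "enat (nat m - 1) < gamma_si V H" by (rule less_le_trans[rotated])
        then obtain A where A: "strongly_independent V H A" "enat (nat m - 1) < gamma V H A"
          using \<open>\<not> has_isolated_vertex V H\<close> by (auto simp: gamma_si_def less_SUP_iff)
        have "enat (nat m) \<le> gamma V H A"
          using Suc_ile_eq[of "nat m - 1" "gamma V H A"] A(2) False by simp
        then have "ereal (of_int m) \<le> ereal_of_enat (gamma V H A)"
          unfolding m ereal_of_enat_simps(1)[symmetric] by (simp only: ereal_of_enat_le_iff)
        with A(1) show ?thesis by blast
      qed
      then obtain A where A: "strongly_independent V H A" "ereal (of_int m) \<le> ereal_of_enat (gamma V H A)"
        by blast
      show ?thesis
      proof (rule acyclic_gamma_si[OF H _ _ _ i])
        show "A \<subseteq> V" "\<And>e. e \<in> H \<Longrightarrow> card (e \<inter> A) \<le> 1"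
          using A(1) by (auto simp: strongly_independent_def independent_set_def)
        show "m \<le> int (card W)" if "W \<subseteq> V" "dominates H W A" for W
          using ereal_of_int_le_enat_INF[OF A(2)[unfolded gamma_def]] that by blast
      qed
    next
      case 3
      then have "ereal (of_int m) \<le>
          ereal_of_enat (INF F\<in>{F. F \<subseteq> H \<and> dominates H (\<Union>F) V}. enat (card F))"
        using False by (simp add: gamma_E_def)
      then have "m \<le> int (card F)" if "F \<subseteq> H" "dominates H (\<Union>F) V" for F
        by (rule ereal_of_int_le_enat_INF) (use that in simp)
      then show ?thesis using i by (rule acyclic_gamma_E[OF H])
    qed
  qed
  then show ?thesis
    by (rule Z2_reduced_homology_trivial[OF simplicial_complex_on_noncover_complex[OF fin]])
qed

end
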